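(* For every fixed integer $k \ge 2$ there is a constant $c_1(k) > 0$ such that the almost balanced ordered biclique covering number $f(n,k)$ of order $k$ of the complete graph $K_n$ satisfies $$f(n,k) \;\ge\; (1+o(1)) \cdot c_1(k) \cdot n^{\frac{1}{\lceil k/2\rceil + 1}} ,$$ where $o(1)$ denotes a quantity tending to $0$ as $n \to \infty$ with $k$ fixed.
   Context: A biclique $B=(U,W)$ in the complete graph $K_n$ is a complete bipartite subgraph given by an ordered pair of disjoint vertex sets: a first class $U$ and a second class $W$. It contains (covers) the edge $\{u,v\}$ if one of $u,v$ lies in $U$ and the other lies in $W$. For a positive integer $k$, an almost balanced ordered biclique covering of order $k$ of $K_n$ is a finite collection of bicliques $(U_1,W_1),\dots,(U_d,W_d)$ such that: (i) every edge of $K_n$ is contained in at least one and at most $k$ of the bicliques; (ii) for every edge $\{u,v\}$, the number of indices $i$ with $u\in U_i$, $v\in W_i$ and the number of indices $i$ with $v\in U_i$, $u\in W_i$ differ by at most one. The number $d$ is the size of the collection, and $f(n,k)$ is the minimum size of an almost balanced ordered biclique covering of order $k$ of $K_n$. *)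

theory Defs
  imports Complex_Main
begin

text \<open>
  The vertex set of \<open>K\<^sub>n\<close> is \<open>{..<n}\<close>; its edges are the pairs of distinct vertices.
  A class of a biclique may be empty. Such a biclique contains no edge and can be dropped
  from any covering, so it does not affect the minimum size.
\<close>

definition biclique :: "nat \<Rightarrow> nat set \<times> nat set \<Rightarrow> bool" where
  "biclique n B \<longleftrightarrow> fst B \<subseteq> {..<n} \<and> snd B \<subseteq> {..<n} \<and> fst B \<inter> snd B = {}"

definition covers :: "nat set \<times> nat set \<Rightarrow> nat \<Rightarrow> nat \<Rightarrow> bool" where
  "covers B u v \<longleftrightarrow> (u \<in> fst B \<and> v \<in> snd B) \<or> (v \<in> fst B \<and> u \<in> snd B)"

definition cover_count :: "(nat set \<times> nat set) list \<Rightarrow> nat \<Rightarrow> nat \<Rightarrow> nat" where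
  "cover_count Bs u v = card {i. i < length Bs \<and> covers (Bs ! i) u v}"

definition oriented_count :: "(nat set \<times> nat set) list \<Rightarrow> nat \<Rightarrow> nat \<Rightarrow> nat" where
  "oriented_count Bs u v = card {i. i < length Bs \<and> u \<in> fst (Bs ! i) \<and> v \<in> snd (Bs ! i)}"

definition almost_balanced_covering ::
    "nat \<Rightarrow> nat \<Rightarrow> (nat set \<times> nat set) list \<Rightarrow> bool" where
  "almost_balanced_covering n k Bs \<longleftrightarrow>
     (\<forall>B \<in> set Bs. biclique n B) \<and>
     (\<forall>u<n. \<forall>v<n. u \<noteq> v \<longrightarrow>
        1 \<le> cover_count Bs u v \<and> cover_count Bs u v \<le> k \<and>
        \<bar>int (oriented_count Bs u v) - int (oriented_count Bs v u)\<bar> \<le> 1)"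

definition covering_number :: "nat \<Rightarrow> nat \<Rightarrow> nat" where
  "covering_number n k = (LEAST d. \<exists>Bs. almost_balanced_covering n k Bs \<and> length Bs = d)"

text \<open>The minimum is taken over a nonempty set: the stars \<open>({i}, {i+1, \<dots>, n-1})\<close> cover
  every edge exactly once.\<close>

lemma almost_balanced_covering_stars:
  assumes "k \<ge> 1"
  shows "almost_balanced_covering n k (map (\<lambda>i. ({i}, {i<..<n})) [0..<n])"
    (is "almost_balanced_covering n k ?S")
proof -
  have c: "{i. i < length ?S \<and> covers (?S ! i) u v} = {min u v}"
    if "u < n" "v < n" "u \<noteq> v" for u v
    using that by (auto simp: covers_def min_def)
  have o: "{i. i < length ?S \<and> u \<in> fst (?S ! i) \<and> v \<in> snd (?S ! i)} = (if u < v then {u} else {})"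
    if "u < n" "v < n" for u v
    using that by auto
  show ?thesis
    unfolding almost_balanced_covering_def cover_count_def oriented_count_def
    using assms by (auto simp: c o biclique_def simp del: length_map length_upt)
qed

lemma covering_number_attained:
  assumes "k \<ge> 1"
  shows "\<exists>Bs. almost_balanced_covering n k Bs \<and> length Bs = covering_number n k"
  unfolding covering_number_def
  by (rule LeastI_ex) (use almost_balanced_covering_stars[OF assms] in blast)

end

theory Submission
  imports Defs "HOL-Library.Function_Algebras" "HOL-Library.Set_Algebras"
begin

text \<open>
  For distinct vertices \<open>u, v\<close> let \<open>a, b\<close> be the numbers of bicliques covering \<open>{u, v}\<close> in the
  two orientations, and put \<open>s = a + b\<close>, \<open>t = a - b\<close>. Then \<open>1 \<le> s \<le> k\<close> and \<open>t\<close> is \<open>0\<close> if \<open>s\<close> is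
  even and \<open>\<plusminus>1\<close> if \<open>s\<close> is odd. With \<open>r = \<lceil>k/2\<rceil>\<close>, \<open>A(s) = \<Prod>(s - 2j)\<close> and \<open>C(s) = \<Prod>(s - (2j - 1))\<close>
  over \<open>1 \<le> j \<le> r\<close>, the polynomial \<open>P = A(s) + t\<^sup>2 (C(s) - A(s))\<close> vanishes on all these pairs but not
  at \<open>s = t = 0\<close>. It has degree only \<open>r + 1\<close>, since \<open>A\<close> and \<open>C\<close> are both monic of degree \<open>r\<close>. For fixed
  \<open>u\<close>, both \<open>s\<close> and \<open>t\<close> are linear combinations of the \<open>2d\<close> class indicators of \<open>v\<close>, so the
  \<open>n\<close> linearly independent functions \<open>v \<mapsto> P\<close> lie in the span of the products of \<open>r + 1\<close> factors, each
  an indicator or \<open>1\<close>. Hence \<open>n \<le> (2d + 1)\<^bsup>r + 1\<^esup>\<close>.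
\<close>

section \<open>Spans of products of real functions\<close>

interpretation fun_space: vector_space "\<lambda>(c :: real) (f :: nat \<Rightarrow> real) x. c * f x"
  by unfold_locales (auto simp: fun_eq_iff algebra_simps)

text \<open>Multiplication is bilinear: expand \<open>f\<close> against a fixed generator of
  \<open>N\<close> first, then expand \<open>g\<close>. Iterated, this puts a product of e elements
  of \<open>span M\<close> into \<open>span (M ^ e)\<close>.\<close>

lemma span_set_times:
  assumes "f \<in> fun_space.span M" and "g \<in> fun_space.span N"
  shows "f * g \<in> fun_space.span (M * N)"
proof -
  have left: "f * h \<in> fun_space.span (M * N)" if "h \<in> N" for h
    using assms(1)
  proof (induction rule: fun_space.span_induct_alt)
    case base
    have "0 * h = 0" by (simp add: fun_eq_iff)
    then show ?case by (simp only: fun_space.span_zero)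
  next
    case (step c x y)
    have "x * h \<in> fun_space.span (M * N)"
      using step that by (blast intro: fun_space.span_base set_times_intro)
    then have "(\<lambda>v. c * (x * h) v) + y * h \<in> fun_space.span (M * N)"
      using step by (intro fun_space.span_add fun_space.span_scale)
    also have "(\<lambda>v. c * (x * h) v) + y * h = ((\<lambda>v. c * x v) + y) * h"
      by (auto simp: fun_eq_iff algebra_simps)
    finally show ?case .
  qed
  show ?thesis
    using assms(2)
  proof (induction rule: fun_space.span_induct_alt)
    case base
    have "f * 0 = 0" by (simp add: fun_eq_iff)
    then show ?case by (simp only: fun_space.span_zero)
  next
    case (step c x y)
    have "(\<lambda>v. c * (f * x) v) + f * y \<in> fun_space.span (M * N)"
      using step left by (intro fun_space.span_add fun_space.span_scale)
    also have "(\<lambda>v. c * (f * x) v) + f * y = f * ((\<lambda>v. c * x v) + y)"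
      by (auto simp: fun_eq_iff algebra_simps)
    finally show ?case .
  qed
qed

text \<open>Padding with the factor 1 lets terms of lower degree join those of higher
  degree.\<close>

lemma span_set_power_Suc:
  assumes "1 \<in> M" and "f \<in> fun_space.span (M ^ e)"
  shows "f \<in> fun_space.span (M ^ Suc e)"
  using span_set_times[OF fun_space.span_base[OF assms(1)] assms(2)] by simp

lemma finite_card_set_power:
  fixes M :: "'a::comm_monoid_mult set"
  assumes "finite M"
  shows "finite (M ^ e) \<and> card (M ^ e) \<le> card M ^ e"
proof (induction e)
  case 0
  then show ?case by (simp add: set_one)
next
  case (Suc e)
  have eq: "M * M ^ e = (\<lambda>(x, y). x * y) ` (M \<times> M ^ e)"
    by (auto simp: set_times_def)
  have "card (M * M ^ e) \<le> card (M \<times> M ^ e)"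
    unfolding eq using assms Suc by (intro card_image_le) auto
  also have "\<dots> \<le> card M * card M ^ e"
    using Suc by (simp add: card_cartesian_product)
  finally show ?case
    using assms Suc eq by simp
qed

text \<open>Vanishing at \<open>u\<close> is preserved by linear combinations and holds for every
  other \<open>F v\<close>, so \<open>F u\<close> is not in their span.\<close>

lemma card_le_of_diagonal_in_span:
  assumes "finite B"
    and "\<And>u. u < n \<Longrightarrow> F u \<in> fun_space.span B"
    and diag: "\<And>u. u < n \<Longrightarrow> F u u \<noteq> 0"
    and off: "\<And>u v. u < n \<Longrightarrow> v < n \<Longrightarrow> u \<noteq> v \<Longrightarrow> F u v = 0"
  shows "n \<le> card B"
proof -
  have inj: "inj_on F {..<n}"
    by (rule inj_onI) (metis diag off lessThan_iff)
  have "fun_space.independent (F ` {..<n})"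
    unfolding fun_space.dependent_def
  proof safe
    fix u assume u: "u < n" "F u \<in> fun_space.span (F ` {..<n} - {F u})"
    have "fun_space.subspace {f. f u = 0}"
      by (auto simp: fun_space.subspace_def)
    moreover have "F ` {..<n} - {F u} \<subseteq> {f. f u = 0}"
      using u off by force
    ultimately have "fun_space.span (F ` {..<n} - {F u}) \<subseteq> {f. f u = 0}"
      by (rule fun_space.span_minimal[rotated])
    then show False using u diag by auto
  qed
  then have "card (F ` {..<n}) \<le> card B"
    using assms by (intro conjunct2[OF fun_space.independent_span_bound]) auto
  then show ?thesis
    by (simp add: card_image inj)
qed

section \<open>The vanishing polynomial and its degree\<close>

text \<open>A, C and P from above are \<open>even_prod\<close>, \<open>odd_prod\<close> and
  \<open>balance_poly\<close>, with the product index shifted to start at 0.\<close>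

definition even_prod :: "nat \<Rightarrow> 'a \<Rightarrow> 'a::comm_ring_1" where
  "even_prod r x = (\<Prod>j<r. x - (2 * of_nat j + 2))"

definition odd_prod :: "nat \<Rightarrow> 'a \<Rightarrow> 'a::comm_ring_1" where
  "odd_prod r x = (\<Prod>j<r. x - (2 * of_nat j + 1))"

definition balance_poly :: "nat \<Rightarrow> 'a \<Rightarrow> 'a \<Rightarrow> 'a::comm_ring_1" where
  "balance_poly r s t = even_prod r s + t\<^sup>2 * (odd_prod r s - even_prod r s)"

lemma balance_poly_zero: "balance_poly r 0 0 \<noteq> (0 :: real)"
proof -
  have "- (2 * real j + 2) \<noteq> 0" for j
    by linarith
  then show ?thesis
    by (simp add: balance_poly_def even_prod_def del: minus_add_distrib)
qed

text \<open>If a = b, then t = 0 and s = 2b is a root of A. Otherwise t^2 = 1, so P collapses to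
  C(s), and s is an odd number below 2r, hence a root of C.\<close>

lemma balance_poly_eq_0:
  assumes "1 \<le> a + b" and "a + b \<le> 2 * r" and "\<bar>int a - int b\<bar> \<le> 1"
  shows "balance_poly r (real a + real b) (real a - real b) = 0"
proof -
  have even: "even_prod r (2 * real c) = 0" if "1 \<le> c" "c \<le> r" for c
    unfolding even_prod_def using that by (intro prod_zero) (auto intro!: bexI[of _ "c - 1"])
  have odd: "odd_prod r (2 * real c + 1) = 0" if "c < r" for c
    unfolding odd_prod_def using that by (intro prod_zero) (auto intro!: bexI[of _ c])
  consider "a = b" | "a = b + 1" | "b = a + 1"
    using assms(3) by linarith
  then show ?thesis
  proof cases
    case 1
    then show ?thesis using even[of b] assms by (simp add: balance_poly_def)
  next
    case 2
    then show ?thesis using odd[of b] assms by (simp add: balance_poly_def algebra_simps)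
  next
    case 3
    then show ?thesis using odd[of a] assms by (simp add: balance_poly_def algebra_simps)
  qed
qed

context
  fixes M :: "(nat \<Rightarrow> real) set" and s :: "nat \<Rightarrow> real"
  assumes one: "1 \<in> M" and s: "s \<in> fun_space.span M"
begin

lemma span_minus_const: "(\<lambda>v. s v - c) \<in> fun_space.span M"
proof -
  have "s - (\<lambda>v. c * 1 v) \<in> fun_space.span M"
    by (intro fun_space.span_diff s fun_space.span_scale fun_space.span_base one)
  then show ?thesis by (simp add: fun_diff_def)
qed

lemma even_prod_in_span: "(\<lambda>v. even_prod r (s v)) \<in> fun_space.span (M ^ r)"
proof (induction r)
  case 0
  then show ?case by (auto simp: even_prod_def set_one one_fun_def intro: fun_space.span_base)
next
  case (Suc r)
  from span_set_times[OF span_minus_const Suc, of "2 * real r + 2"] show ?case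
    by (simp add: even_prod_def times_fun_def mult.commute)
qed

text \<open>The leading terms cancel: \<open>C\<^sub>r\<^sub>+\<^sub>1 - A\<^sub>r\<^sub>+\<^sub>1 = (s - (2r + 1)) (C\<^sub>r - A\<^sub>r) + A\<^sub>r\<close>.\<close>

lemma odd_minus_even_prod_in_span:
  "(\<lambda>v. odd_prod (Suc r) (s v) - even_prod (Suc r) (s v)) \<in> fun_space.span (M ^ r)"
proof (induction r)
  case 0
  \<comment> \<open>Here the difference is (s - 1) - (s - 2) = 1.\<close>
  then show ?case
    by (auto simp: odd_prod_def even_prod_def set_one one_fun_def intro: fun_space.span_base)
next
  case (Suc r)
  let ?D = "\<lambda>v. odd_prod (Suc r) (s v) - even_prod (Suc r) (s v)"
  have "(\<lambda>v. s v - (2 * real (Suc r) + 1)) * ?D + (\<lambda>v. even_prod (Suc r) (s v))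
          \<in> fun_space.span (M ^ Suc r)"
    using span_set_times[OF span_minus_const Suc] even_prod_in_span[of "Suc r"]
    by (intro fun_space.span_add) simp_all
  moreover have "odd_prod (Suc (Suc r)) x - even_prod (Suc (Suc r)) x =
      (x - (2 * real (Suc r) + 1)) * (odd_prod (Suc r) x - even_prod (Suc r) x)
        + even_prod (Suc r) x" for x
    unfolding odd_prod_def even_prod_def prod.lessThan_Suc[of _ "Suc r"]
    by (simp only: of_nat_Suc) (simp add: algebra_simps)
  ultimately show ?case
    by (simp add: times_fun_def plus_fun_def)
qed

text \<open>Degree count: t^2 contributes 2 and C - A only r - 1; the summand A of degree r is
  padded by one factor.\<close>

lemma balance_poly_in_span:
  assumes "1 \<le> r" and t: "t \<in> fun_space.span M"
  shows "(\<lambda>v. balance_poly r (s v) (t v)) \<in> fun_space.span (M ^ Suc r)"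
proof -
  obtain q where r: "r = Suc q"
    using assms(1) by (cases r) auto
  have "t * (t * (\<lambda>v. odd_prod r (s v) - even_prod r (s v))) \<in> fun_space.span (M ^ Suc r)"
    using span_set_times[OF t span_set_times[OF t odd_minus_even_prod_in_span[of q]]]
    by (simp add: r)
  with span_set_power_Suc[OF one even_prod_in_span, of r]
  have "(\<lambda>v. even_prod r (s v)) + t * (t * (\<lambda>v. odd_prod r (s v) - even_prod r (s v)))
          \<in> fun_space.span (M ^ Suc r)"
    by (rule fun_space.span_add)
  then show ?thesis
    by (simp add: balance_poly_def times_fun_def plus_fun_def power2_eq_square mult.assoc)
qed

end

section \<open>Coverings and their class indicators\<close>

lemma sum_fun_apply: "(\<Sum>i\<in>I. f i) x = (\<Sum>i\<in>I. f i x)"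
  by (induction I rule: infinite_finite_induct) auto

text \<open>For fixed \<open>u\<close> this is linear in the indicators of \<open>v\<close>, and for
  fixed \<open>v\<close> in those of \<open>u\<close>.\<close>

lemma oriented_count_eq_sum:
  "real (oriented_count Bs u v) =
     (\<Sum>i<length Bs. of_bool (u \<in> fst (Bs ! i)) * of_bool (v \<in> snd (Bs ! i)))"
proof -
  have "{i. i < length Bs \<and> u \<in> fst (Bs ! i) \<and> v \<in> snd (Bs ! i)} =
      {i \<in> {..<length Bs}. u \<in> fst (Bs ! i) \<and> v \<in> snd (Bs ! i)}"
    by auto
  then show ?thesis
    unfolding oriented_count_def
    by (simp only: of_bool_conj[symmetric]) (simp add: sum_of_bool_eq Int_def)
qed

text \<open>The classes are disjoint, so no biclique covers a pair in both orientations.\<close>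

lemma cover_count_eq:
  assumes "\<forall>B \<in> set Bs. biclique n B"
  shows "cover_count Bs u v = oriented_count Bs u v + oriented_count Bs v u"
proof -
  let ?I = "\<lambda>u v. {i. i < length Bs \<and> u \<in> fst (Bs ! i) \<and> v \<in> snd (Bs ! i)}"
  have "fst (Bs ! i) \<inter> snd (Bs ! i) = {}" if "i < length Bs" for i
    using assms that nth_mem unfolding biclique_def by blast
  then have "?I u v \<inter> ?I v u = {}"
    by blast
  then have "card (?I u v \<union> ?I v u) = card (?I u v) + card (?I v u)"
    by (intro card_Un_disjoint) auto
  moreover have "{i. i < length Bs \<and> covers (Bs ! i) u v} = ?I u v \<union> ?I v u"
    by (auto simp: covers_def)
  ultimately show ?thesis
    by (simp add: cover_count_def oriented_count_def)
qed

lemma oriented_count_self: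
  assumes "\<forall>B \<in> set Bs. biclique n B"
  shows "oriented_count Bs u u = 0"
proof -
  have "fst (Bs ! i) \<inter> snd (Bs ! i) = {}" if "i < length Bs" for i
    using assms that nth_mem unfolding biclique_def by blast
  then have "{i. i < length Bs \<and> u \<in> fst (Bs ! i) \<and> u \<in> snd (Bs ! i)} = {}"
    by blast
  then show ?thesis
    by (simp only: oriented_count_def card.empty)
qed

lemma order_le_of_almost_balanced_covering:
  assumes cov: "almost_balanced_covering n k Bs" and "k \<le> 2 * r" and "1 \<le> r"
  shows "n \<le> (2 * length Bs + 1) ^ Suc r"
proof -
  let ?d = "length Bs"
  define p q :: "nat \<Rightarrow> nat \<Rightarrow> real"
    where "p i v = of_bool (v \<in> fst (Bs ! i))" and "q i v = of_bool (v \<in> snd (Bs ! i))" for i v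
  define M where "M = insert 1 (p ` {..<?d} \<union> q ` {..<?d})"
  have fin: "finite M" and one: "1 \<in> M"
    by (simp_all add: M_def)
  have "card (p ` {..<?d} \<union> q ` {..<?d}) \<le> ?d + ?d"
    using card_Un_le[of "p ` {..<?d}" "q ` {..<?d}"]
      card_image_le[of "{..<?d}" p] card_image_le[of "{..<?d}" q] by simp
  then have card_M: "card M \<le> 2 * ?d + 1"
    unfolding M_def by (intro order.trans[OF card_insert_le_m1]) auto
  define a b where "a u v = real (oriented_count Bs u v)" and "b u v = a v u" for u v
  have "(\<Sum>i<?d. (\<lambda>v. p i u * q i v)) \<in> fun_space.span M" for u
    by (intro fun_space.span_sum fun_space.span_scale fun_space.span_base) (simp add: M_def)
  moreover have "a u = (\<Sum>i<?d. (\<lambda>v. p i u * q i v))" for u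
    by (simp add: fun_eq_iff sum_fun_apply a_def oriented_count_eq_sum p_def q_def
        del: of_bool_conj sum_mult_of_bool_eq sum_of_bool_mult_eq)
  ultimately have a: "a u \<in> fun_space.span M" for u
    by simp
  have "(\<Sum>i<?d. (\<lambda>v. q i u * p i v)) \<in> fun_space.span M" for u
    by (intro fun_space.span_sum fun_space.span_scale fun_space.span_base) (simp add: M_def)
  moreover have "b u = (\<Sum>i<?d. (\<lambda>v. q i u * p i v))" for u
    by (simp add: fun_eq_iff sum_fun_apply b_def a_def oriented_count_eq_sum p_def q_def mult.commute
        del: of_bool_conj sum_mult_of_bool_eq sum_of_bool_mult_eq)
  ultimately have b: "b u \<in> fun_space.span M" for u
    by simp
  define F where "F u v = balance_poly r ((a u + b u) v) ((a u - b u) v)" for u v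
  have bic: "\<forall>B \<in> set Bs. biclique n B"
    using cov by (simp add: almost_balanced_covering_def)
  have "n \<le> card (M ^ Suc r)"
  proof (rule card_le_of_diagonal_in_span[where F = F])
    show "finite (M ^ Suc r)"
      using finite_card_set_power[OF fin] by blast
    show "F u \<in> fun_space.span (M ^ Suc r)" for u
      unfolding F_def
      by (intro balance_poly_in_span one fun_space.span_add fun_space.span_diff a b \<open>1 \<le> r\<close>)
    \<comment> \<open>On the diagonal both oriented counts are 0, which leaves P(0, 0).\<close>
    show "F u u \<noteq> 0" for u
      using balance_poly_zero by (simp add: F_def a_def b_def oriented_count_self[OF bic])
    show "F u v = 0" if "u < n" "v < n" "u \<noteq> v" for u v
    proof -
      have "1 \<le> cover_count Bs u v" "cover_count Bs u v \<le> k"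
        "\<bar>int (oriented_count Bs u v) - int (oriented_count Bs v u)\<bar> \<le> 1"
        using cov that by (auto simp: almost_balanced_covering_def)
      then show ?thesis
        using balance_poly_eq_0[of "oriented_count Bs u v" "oriented_count Bs v u" r] \<open>k \<le> 2 * r\<close>
        by (simp add: cover_count_eq[OF bic] F_def a_def b_def)
    qed
  qed
  also have "\<dots> \<le> card M ^ Suc r"
    using finite_card_set_power[OF fin] by blast
  also have "\<dots> \<le> (2 * ?d + 1) ^ Suc r"
    using card_M by (rule power_mono) simp
  finally show ?thesis .
qed

section \<open>The asymptotic bound\<close>

lemma covering_number_lower_bound:
  assumes "1 \<le> k" and "2 \<le> n"
  shows "real n powr (1 / (real_of_int \<lceil>real k / 2\<rceil> + 1)) \<le> 3 * real (covering_number n k)"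
proof -
  define r where "r = nat \<lceil>real k / 2\<rceil>"
  have ceil: "real_of_int \<lceil>real k / 2\<rceil> = real r"
    by (simp add: r_def)
  have "real k \<le> 2 * real r"
    using le_of_int_ceiling[of "real k / 2"] ceil by linarith
  then have r: "k \<le> 2 * r" "1 \<le> r"
    using assms by linarith+
  obtain Bs where Bs: "almost_balanced_covering n k Bs" "length Bs = covering_number n k"
    using covering_number_attained[OF assms(1)] by blast
  define d where "d = covering_number n k"
  have n: "n \<le> (2 * d + 1) ^ Suc r"
    using order_le_of_almost_balanced_covering[OF Bs(1) r] by (simp add: Bs(2) d_def)
  \<comment> \<open>For d = 0 the bound would read n \<le> 1. With d \<ge> 1, 2d + 1 \<le> 3d, which
    is the source of the constant 1/3.\<close>
  have "1 \<le> d"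
    using n assms by (cases d) auto
  then have "(2 * d + 1) ^ Suc r \<le> (3 * d) ^ Suc r"
    by (intro power_mono) auto
  with n have "n \<le> (3 * d) ^ Suc r"
    by (rule order.trans)
  then have "real n \<le> real ((3 * d) ^ Suc r)"
    by (simp only: of_nat_le_iff)
  also have "\<dots> = (3 * real d) powr (real r + 1)"
    using \<open>1 \<le> d\<close> powr_realpow[of "3 * real d" "Suc r"] by (simp add: add.commute)
  finally have "real n powr (1 / (real r + 1)) \<le>
      ((3 * real d) powr (real r + 1)) powr (1 / (real r + 1))"
    by (intro powr_mono2) auto
  also have "\<dots> = 3 * real d"
    using \<open>1 \<le> d\<close> by (simp add: powr_powr)
  finally show ?thesis
    by (simp add: ceil d_def)
qed

theorem theorem1:
  fixes k :: nat
  assumes "k \<ge> 2"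
  shows "\<exists>c1 :: real. c1 > 0 \<and>
           (\<exists>\<epsilon> :: nat \<Rightarrow> real. \<epsilon> \<longlonglongrightarrow> 0 \<and>
             (\<forall>n\<ge>1. real (covering_number n k) \<ge>
                (1 + \<epsilon> n) * c1 * real n powr (1 / (real_of_int \<lceil>real k / 2\<rceil> + 1))))"
proof -
  \<comment> \<open>\<open>K\<^sub>1\<close> has no edges and covering number \<open>0\<close>, so the bound needs \<open>\<epsilon> 1 = -1\<close>.\<close>
  define \<epsilon> :: "nat \<Rightarrow> real" where "\<epsilon> n = (if n < 2 then - 1 else 0)" for n
  have "\<forall>\<^sub>F n in sequentially. \<epsilon> n = 0"
    using eventually_ge_at_top[of 2] by eventually_elim (simp add: \<epsilon>_def)
  then have "\<epsilon> \<longlonglongrightarrow> 0"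
    by (rule tendsto_eventually)
  moreover have "real (covering_number n k) \<ge>
      (1 + \<epsilon> n) * (1 / 3) * real n powr (1 / (real_of_int \<lceil>real k / 2\<rceil> + 1))" for n
    using covering_number_lower_bound[of k n] assms by (cases "n < 2") (auto simp: \<epsilon>_def)
  ultimately show ?thesis
    by (intro exI[of _ "1 / 3"] conjI exI[of _ \<epsilon>]) auto
qed

end
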